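(* Let $(\Omega,F,P)$ be a probability space, and let $X_1,X_2,\dots$ and $X_\infty$ be random variables $\Omega\to\mathbb{R}^{**}$ that are finite almost everywhere, i.e. $P(X_n\in\mathbb{R})=1$ for every $n\ge 1$ and $P(X_\infty\in\mathbb{R})=1$. Let $A=(a_{ij})$, $i=1,2,\dots$, $j=0,1,2,\dots$, be a double sequence of real constants defining a regular method of summability with norm $M$, that is: 1. $\sup_{1\le i<\infty}\sum_{j=0}^{\infty}|a_{ij}|=M<\infty$; 2. $\lim_{i\to\infty}a_{ij}=0$ for each $j=1,2,\dots$; 3. $\lim_{i\to\infty}\sum_{j=1}^{\infty}a_{ij}=1$. Write $(Ax)_n=\sum_{j=1}^{\infty}a_{nj}X_j$ for $n=1,2,\dots$. If $X_n\xrightarrow{\mathrm{a.s.}}X_\infty$, then $(Ax)_n\xrightarrow{\mathrm{a.s.}}X_\infty$.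
   Context: Extended real numbers $\mathbb{R}^{**}$: let $\mathbb{R}^{**}$ be a 2-dimensional real vector space with basis $(1,\infty)$, so every element is uniquely $u=a+b\cdot\infty$ with $a,b\in\mathbb{R}$; $\mathbb{R}$ is identified with $\{a\cdot 1: a\in\mathbb{R}\}$. It carries the lexicographic order: $a+b\cdot\infty<c+d\cdot\infty$ iff $b<d$, or $b=d$ and $a<c$. The absolute value is $|a+b\cdot\infty|:=|a|+|b|\cdot\infty$, which on $\mathbb{R}$ is the usual one. Elements of $\mathbb{R}^{**}\setminus\mathbb{R}$ are called infinite. Almost sure convergence: $Y_n\xrightarrow{\mathrm{a.s.}}Y_\infty$ means, by definition, that for every real $\lambda>0$, $$\lim_{n\to\infty}P\Big(\sup_{n\le m<\infty}|Y_m-Y_\infty|>\lambda\Big)=0.$$ Here $x=(X_1,X_2,\dots)$ is the sequence of random variables. Since countably many a.e. finite random variables are simultaneously finite on a set of probability one, the statement (and the values of $(Ax)_n$) is only concerned with a full-measure set on which all $X_n$ and $X_\infty$ are real-valued. What happens on a null set is irrelevant. *)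

theory Defs
  imports "HOL-Probability.Probability"
begin

text \<open>The extended real numbers \<open>a + b \<cdot> \<infinity>\<close>: a two-dimensional real vector space with basis
  \<open>(1, \<infinity>)\<close>. \<open>Ext a b\<close> stands for \<open>a + b \<cdot> \<infinity>\<close>.\<close>

datatype extr = Ext (fin_part: real) (inf_part: real)

instantiation extr :: real_vector
begin

definition zero_extr :: extr where "0 = Ext 0 0"
definition plus_extr :: "extr \<Rightarrow> extr \<Rightarrow> extr" where
  "u + v = Ext (fin_part u + fin_part v) (inf_part u + inf_part v)"
definition minus_extr :: "extr \<Rightarrow> extr \<Rightarrow> extr" where
  "u - v = Ext (fin_part u - fin_part v) (inf_part u - inf_part v)"
definition uminus_extr :: "extr \<Rightarrow> extr" where
  "- u = Ext (- fin_part u) (- inf_part u)"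
definition scaleR_extr :: "real \<Rightarrow> extr \<Rightarrow> extr" where
  "c *\<^sub>R u = Ext (c * fin_part u) (c * inf_part u)"

instance
  by standard
    (simp_all add: zero_extr_def plus_extr_def minus_extr_def uminus_extr_def scaleR_extr_def
      algebra_simps)

end

instantiation extr :: "{one, infinity, abs}"
begin

definition one_extr :: extr where "1 = Ext 1 0"
definition infinity_extr :: extr where "\<infinity> = Ext 0 1"

text \<open>This is not the absolute value \<open>max u (- u)\<close> of the ordered group.\<close>

definition abs_extr :: "extr \<Rightarrow> extr" where
  "\<bar>u\<bar> = Ext \<bar>fin_part u\<bar> \<bar>inf_part u\<bar>"

instance ..

end

lemma extr_eq_basis: "Ext a b = a *\<^sub>R 1 + b *\<^sub>R \<infinity>"
  by (simp add: scaleR_extr_def plus_extr_def one_extr_def infinity_extr_def)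

definition extr_reals :: "extr set" where
  "extr_reals = range (\<lambda>a. a *\<^sub>R 1)"

instantiation extr :: linorder
begin

definition less_extr :: "extr \<Rightarrow> extr \<Rightarrow> bool" where
  "u < v \<longleftrightarrow> inf_part u < inf_part v \<or> inf_part u = inf_part v \<and> fin_part u < fin_part v"
definition less_eq_extr :: "extr \<Rightarrow> extr \<Rightarrow> bool" where
  "u \<le> v \<longleftrightarrow> u < v \<or> u = (v :: extr)"

instance
  by standard (auto simp: less_extr_def less_eq_extr_def extr.expand intro!: extr.expand)

end

text \<open>The order topology gives infinite series a meaning. On the real line, which is an open
  subset, it is the usual topology, so series of finite terms are the usual real series.\<close>

instantiation extr :: linorder_topology
begin

definition open_extr :: "extr set \<Rightarrow> bool" where
  "open_extr = generate_topology (range (\<lambda>a. {..<a}) \<union> range (\<lambda>a. {a<..}))"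

instance by standard (rule open_extr_def)

end

text \<open>A random variable \<open>X\<close> is required to have measurable events \<open>X \<le> u\<close> for all \<open>u\<close>. The
  \<open>\<sigma>\<close>-algebra generated by these rays is contained in the Borel \<open>\<sigma>\<close>-algebras of both the order
  topology and the Euclidean topology of the plane (in general strictly), so this is the weakest
  of the usual measurability requirements.\<close>

definition extr_rays :: "extr measure" where
  "extr_rays = sigma UNIV (range atMost)"

text \<open>The lexicographic order is not complete (the set of reals has no supremum), so suprema are
  taken after the monotone collapse of all positive (negative) infinite elements to \<open>\<infinity>\<close>
  (\<open>-\<infinity>\<close>) in \<open>ereal\<close>. This does not affect comparisons with real numbers.\<close>

definition collapse :: "extr \<Rightarrow> ereal" where
  "collapse u = (if inf_part u = 0 then ereal (fin_part u) else if inf_part u > 0 then \<infinity> else -\<infinity>)"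

text \<open>The event need not be measurable on the null set where some of the variables are infinite
  (differences of random variables need not be random variables there), so its probability is
  taken in the completion.\<close>

definition as_converges :: "'w measure \<Rightarrow> (nat \<Rightarrow> 'w \<Rightarrow> extr) \<Rightarrow> ('w \<Rightarrow> extr) \<Rightarrow> bool" where
  "as_converges P Y Z \<longleftrightarrow>
    (\<forall>l>0. (\<lambda>n. measure (completion P)
        {w \<in> space P. (SUP m\<in>{n..}. collapse \<bar>Y m w - Z w\<bar>) > ereal l}) \<longlonglongrightarrow> 0)"

text \<open>Rows of \<open>a\<close> are indexed from 1 and columns from 0, but column 0 only enters the norm
  condition. The first condition makes the rows summable.\<close>

definition regular_summability :: "(nat \<Rightarrow> nat \<Rightarrow> real) \<Rightarrow> real \<Rightarrow> bool" where
  "regular_summability a K \<longleftrightarrow>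
    (SUP i\<in>{1..}. \<Sum>j. ereal \<bar>a i j\<bar>) = ereal K \<and>
    (\<forall>j\<ge>1. (\<lambda>i. a i j) \<longlonglongrightarrow> 0) \<and>
    (\<lambda>i. \<Sum>j. a i (Suc j)) \<longlonglongrightarrow> 1"

text \<open>The shift lets the sum run over \<open>j \<ge> 1\<close>.\<close>

definition matrix_transform ::
  "(nat \<Rightarrow> nat \<Rightarrow> real) \<Rightarrow> (nat \<Rightarrow> 'w \<Rightarrow> extr) \<Rightarrow> nat \<Rightarrow> 'w \<Rightarrow> extr" where
  "matrix_transform a X n w = (\<Sum>j. a n (Suc j) *\<^sub>R X (Suc j) w)"

end

theory Submission imports Defs begin

text \<open>For real random variables, the definition of almost sure convergence says that the events
  \<open>E\<^sub>n = {\<exists>m\<ge>n. \<bar>Y\<^sub>m - Z\<bar> > l}\<close> have probability tending to zero for each \<open>l > 0\<close>. These events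
  decrease, so by continuity of the measure this means that \<open>\<Inter>n. E\<^sub>n\<close> is a null set for each
  \<open>l > 0\<close>, and letting \<open>l\<close> run through the numbers \<open>1 / (k + 1)\<close> this is pointwise convergence
  outside a null set (\<open>AE_LIMSEQ_iff_measure_tail_deviation\<close>). Extended real random variables that
  are almost surely finite reduce to real ones because changing the events on a null set does not
  affect their measure in the completion (\<open>as_converges_iff_AE_LIMSEQ\<close>).

  What remains is the deterministic theorem of Toeplitz (\<open>Toeplitz_LIMSEQ\<close>): at almost every point
  the sequence \<open>X\<^sub>j\<close> is real and converges, hence its transform by a regular matrix converges to the
  same limit. The series that defines the transform is taken in the order topology of the extended
  reals; as the embedding of the reals is continuous, its sum is the usual real one whenever
  the real series converges, and it does since the rows are absolutely summable and convergent
  sequences are bounded.\<close>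

section \<open>The reals inside the extended reals\<close>

lemma extr_reals_iff: "u \<in> extr_reals \<longleftrightarrow> u = Ext (fin_part u) 0"
  by (cases u) (auto simp: extr_reals_def scaleR_extr_def one_extr_def)

lemma sum_Ext_0: "(\<Sum>j\<in>A. Ext (f j) 0) = Ext (\<Sum>j\<in>A. f j) 0"
  by (induction A rule: infinite_finite_induct) (simp_all add: zero_extr_def plus_extr_def)

text \<open>A ray with an infinite end point traces either all reals or none, so the order topology
  induces no more open sets on the reals than the usual ones.\<close>

lemma tendsto_Ext_0:
  assumes "(f \<longlongrightarrow> l) F"
  shows "((\<lambda>x. Ext (f x) 0) \<longlongrightarrow> Ext l 0) F"
proof (rule order_tendstoI)
  fix u assume "u < Ext l 0"
  then show "\<forall>\<^sub>F x in F. u < Ext (f x) 0"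
    using order_tendstoD(1)[OF assms, of "fin_part u"]
    by (cases "inf_part u < 0") (auto simp: less_extr_def elim: eventually_mono)
next
  fix u assume "Ext l 0 < u"
  then show "\<forall>\<^sub>F x in F. Ext (f x) 0 < u"
    using order_tendstoD(2)[OF assms, of "fin_part u"]
    by (cases "inf_part u > 0") (auto simp: less_extr_def elim: eventually_mono)
qed

lemma suminf_Ext_0:
  assumes "summable f"
  shows "(\<Sum>j. Ext (f j) 0) = Ext (\<Sum>j. f j) 0"
  using tendsto_Ext_0[OF summable_LIMSEQ[OF assms]]
  by (intro sums_unique[symmetric]) (simp add: sums_def sum_Ext_0)

section \<open>Almost sure convergence as pointwise convergence\<close>

text \<open>Failure of convergence at a point means that, for some \<open>k\<close>, the point lies in all the
  decreasing events of a deviation beyond \<open>1 / (k + 1)\<close> after time \<open>n\<close>.\<close>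

lemma (in finite_measure) AE_LIMSEQ_iff_measure_tail_deviation:
  fixes y :: "nat \<Rightarrow> 'a \<Rightarrow> real"
  assumes [measurable]: "\<And>n. y n \<in> borel_measurable M" "z \<in> borel_measurable M"
  shows "(AE w in M. (\<lambda>n. y n w) \<longlonglongrightarrow> z w) \<longleftrightarrow>
    (\<forall>l>0. (\<lambda>n. measure M {w \<in> space M. \<exists>m\<in>{n..}. \<bar>y m w - z w\<bar> > l}) \<longlonglongrightarrow> 0)"
proof -
  define E where "E l n = {w \<in> space M. \<exists>m\<in>{n..}. \<bar>y m w - z w\<bar> > l}" for l n
  have E_sets [measurable]: "E l n \<in> sets M" for l n
    unfolding E_def by measurable
  have "decseq (E l)" for l
    by (rule decseq_SucI) (auto simp: E_def)
  then have lim: "(\<lambda>n. measure M (E l n)) \<longlonglongrightarrow> measure M (\<Inter>n. E l n)" for l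
    by (intro finite_Lim_measure_decseq) auto
  have "(\<lambda>n. measure M (E l n)) \<longlonglongrightarrow> 0 \<longleftrightarrow> measure M (\<Inter>n. E l n) = 0" for l
    using lim[of l] LIMSEQ_unique by metis
  also have "measure M (\<Inter>n. E l n) = 0 \<longleftrightarrow> (AE w in M. w \<notin> (\<Inter>n. E l n))" for l
    by (subst AE_iff_measurable[of "\<Inter>n. E l n"])
      (auto simp: E_def emeasure_eq_measure)
  finally have null: "(\<lambda>n. measure M (E l n)) \<longlonglongrightarrow> 0 \<longleftrightarrow> (AE w in M. w \<notin> (\<Inter>n. E l n))" for l .
  show ?thesis
  proof (intro iffI allI impI)
    fix l :: real
    assume conv: "AE w in M. (\<lambda>n. y n w) \<longlonglongrightarrow> z w" and "l > 0"
    have "AE w in M. w \<notin> (\<Inter>n. E l n)"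
      using conv
    proof eventually_elim
      case (elim w)
      from LIMSEQ_D[OF elim \<open>l > 0\<close>] obtain N where "\<forall>n\<ge>N. \<bar>y n w - z w\<bar> < l"
        by (auto simp: real_norm_def)
      then have "w \<notin> E l N" by (force simp: E_def)
      then show ?case by blast
    qed
    then show "(\<lambda>n. measure M {w \<in> space M. \<exists>m\<in>{n..}. \<bar>y m w - z w\<bar> > l}) \<longlonglongrightarrow> 0"
      using null[of l] by (simp add: E_def)
  next
    assume "\<forall>l>0. (\<lambda>n. measure M {w \<in> space M. \<exists>m\<in>{n..}. \<bar>y m w - z w\<bar> > l}) \<longlonglongrightarrow> 0"
    then have "AE w in M. w \<notin> (\<Inter>n. E (inverse (real (Suc k))) n)" for k
      using null by (simp add: E_def)
    then have "AE w in M. \<forall>k. w \<notin> (\<Inter>n. E (inverse (real (Suc k))) n)"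
      by (simp add: AE_all_countable)
    with AE_space show "AE w in M. (\<lambda>n. y n w) \<longlonglongrightarrow> z w"
    proof eventually_elim
      case (elim w)
      show ?case
      proof (rule LIMSEQ_I)
        fix r :: real assume "r > 0"
        then obtain k where k: "inverse (real (Suc k)) < r" using reals_Archimedean by blast
        from elim obtain n where "w \<notin> E (inverse (real (Suc k))) n" by blast
        with elim have "\<forall>m\<ge>n. \<bar>y m w - z w\<bar> \<le> inverse (real (Suc k))"
          by (auto simp: E_def not_less)
        with k show "\<exists>N. \<forall>n\<ge>N. norm (y n w - z w) < r" by force
      qed
    qed
  qed
qed

text \<open>Off a null set the extended deviations are the real ones, so the events of both notions
  differ by null sets; this is why the possibly non-measurable extended events belong to the
  completion and have the same probability. Sequences are numbered from 1, and a limit does not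
  see index 0.\<close>

lemma (in prob_space) as_converges_iff_AE_LIMSEQ:
  fixes y :: "nat \<Rightarrow> 'a \<Rightarrow> real"
  assumes [measurable]: "\<And>n. y n \<in> borel_measurable M" "z \<in> borel_measurable M"
    and fin: "AE w in M. Z w = Ext (z w) 0 \<and> (\<forall>n\<ge>1. Y n w = Ext (y n w) 0)"
  shows "as_converges M Y Z \<longleftrightarrow> (AE w in M. (\<lambda>n. y n w) \<longlonglongrightarrow> z w)"
proof -
  define E where "E l n = {w \<in> space M. \<exists>m\<in>{n..}. \<bar>y m w - z w\<bar> > l}" for l n
  define F where "F l n = {w \<in> space M. (SUP m\<in>{n..}. collapse \<bar>Y m w - Z w\<bar>) > ereal l}" for l n
  have E_sets [measurable]: "E l n \<in> sets M" for l n
    unfolding E_def by measurable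
  have "measure (completion M) (F l n) = measure M (E l n)" if "n \<ge> 1" for l n
  proof -
    have "AE w in M. w \<in> E l n \<longleftrightarrow> w \<in> F l n"
      using fin AE_space
    proof eventually_elim
      case (elim w)
      then have "collapse \<bar>Y m w - Z w\<bar> = ereal \<bar>y m w - z w\<bar>" if "m \<ge> n" for m
        using that \<open>n \<ge> 1\<close> by (simp add: collapse_def minus_extr_def abs_extr_def)
      then show ?case
        using elim by (auto simp: E_def F_def less_SUP_iff)
    qed
    then have eq: "AE w in completion M. w \<in> E l n \<longleftrightarrow> w \<in> F l n"
      by (rule AE_completion)
    have "F l n \<in> sets (completion M)"
      by (rule completion.in_sets_AE[OF eq]) (auto simp: F_def)
    then have "measure (completion M) (F l n) = measure (completion M) (E l n)"
      using eq by (intro measure_eq_AE) auto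
    then show ?thesis by simp
  qed
  then have "\<forall>\<^sub>F n in sequentially. measure (completion M) (F l n) = measure M (E l n)" for l
    by (auto simp: eventually_sequentially)
  then have "(\<lambda>n. measure (completion M) (F l n)) \<longlonglongrightarrow> 0 \<longleftrightarrow> (\<lambda>n. measure M (E l n)) \<longlonglongrightarrow> 0" for l
    by (rule tendsto_cong)
  then show ?thesis
    by (simp add: as_converges_def AE_LIMSEQ_iff_measure_tail_deviation E_def F_def)
qed

text \<open>The witness is the finite part, set to 0 where \<open>V\<close> is infinite. The finite part itself need not
  be measurable there: a set in the \<open>\<sigma>\<close>-algebra of the rays is determined by countably many of them,
  so it contains or misses as a whole each line of elements with a given coefficient of \<open>\<infinity>\<close>,
  with at most countably many exceptions, while a half-plane bounding the finite part cuts them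
  all.\<close>

lemma (in prob_space) ex_borel_measurable_fin_part:
  assumes V: "V \<in> measurable M extr_rays"
    and fin: "measure M {w \<in> space M. V w \<in> extr_reals} = 1"
  shows "\<exists>v \<in> borel_measurable M. AE w in M. V w = Ext (v w) 0"
proof
  define G where "G = {w \<in> space M. V w \<in> extr_reals}"
  define v where "v w = (if V w \<in> extr_reals then fin_part (V w) else 0)" for w
  \<comment> \<open>A non-measurable set has measure 0 by convention.\<close>
  have G [measurable]: "G \<in> sets M"
    using fin measure_notin_sets[of G M] by (auto simp: G_def)
  have "AE w in M. w \<in> G"
    using fin G prob_eq_1 by (auto simp: G_def)
  then show "AE w in M. V w = Ext (v w) 0"
    by eventually_elim (auto simp: G_def v_def extr_reals_iff)
  have ray [measurable]: "V -` {..Ext c 0} \<inter> space M \<in> sets M" for c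
    by (rule measurable_sets[OF V]) (auto simp: extr_rays_def)
  show "v \<in> borel_measurable M"
  proof (rule borel_measurable_iff_le[THEN iffD2], intro allI)
    fix c
    have "{w \<in> space M. v w \<le> c} = V -` {..Ext c 0} \<inter> space M \<inter> G \<union> (if 0 \<le> c then space M - G else {})"
    proof (rule set_eqI)
      fix w
      have "V w \<le> Ext c 0 \<longleftrightarrow> fin_part (V w) \<le> c" if "V w \<in> extr_reals"
        using that by (cases "V w") (auto simp: extr_reals_iff less_eq_extr_def less_extr_def)
      then show "w \<in> {w \<in> space M. v w \<le> c} \<longleftrightarrow>
          w \<in> V -` {..Ext c 0} \<inter> space M \<inter> G \<union> (if 0 \<le> c then space M - G else {})"
        by (auto simp: G_def v_def)
    qed
    also have "\<dots> \<in> sets M" by simp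
    finally show "{w \<in> space M. v w \<le> c} \<in> sets M" .
  qed
qed

section \<open>Regular summability\<close>

lemma summable_abs_mult_Bseq:
  fixes b y :: "nat \<Rightarrow> real"
  assumes b: "summable (\<lambda>j. \<bar>b j\<bar>)" and y: "Bseq y"
  shows "summable (\<lambda>j. b j * y j)"
proof -
  obtain B where B: "\<And>j. \<bar>y j\<bar> \<le> B" using y by (auto simp: Bseq_def)
  have "summable (\<lambda>j. \<bar>b j\<bar> * B)" using b by (rule summable_mult2)
  then show ?thesis
    by (rule summable_comparison_test') (auto simp: abs_mult intro!: mult_left_mono B)
qed

text \<open>Once the tail of the null sequence is below \<open>e\<close>, it contributes at most \<open>K * e\<close> to each row
  from \<open>m\<close> on, whereas the finitely many earlier columns vanish in the limit.\<close>

lemma Toeplitz_LIMSEQ_zero: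
  fixes b :: "nat \<Rightarrow> nat \<Rightarrow> real"
  assumes rows: "\<And>i. i \<ge> m \<Longrightarrow> summable (\<lambda>j. \<bar>b i j\<bar>)" "\<And>i. i \<ge> m \<Longrightarrow> (\<Sum>j. \<bar>b i j\<bar>) \<le> K"
    and columns: "\<And>j. (\<lambda>i. b i j) \<longlonglongrightarrow> 0"
    and y: "y \<longlonglongrightarrow> 0"
  shows "(\<lambda>i. \<Sum>j. b i j * y j) \<longlonglongrightarrow> 0"
proof (rule LIMSEQ_I)
  fix r :: real assume "r > 0"
  have "0 \<le> K"
    using suminf_nonneg[OF rows(1)[of m]] rows(2)[of m] by simp
  \<comment> \<open>Adding 1 keeps the denominator positive when \<open>K = 0\<close>.\<close>
  define e where "e = r / (2 * (K + 1))"
  have "e > 0" using \<open>r > 0\<close> \<open>0 \<le> K\<close> by (simp add: e_def)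
  have Ke: "K * e < r / 2"
    using \<open>r > 0\<close> \<open>0 \<le> K\<close> by (simp add: e_def field_simps)
  from LIMSEQ_D[OF y \<open>e > 0\<close>] obtain N where N: "\<And>j. j \<ge> N \<Longrightarrow> \<bar>y j\<bar> \<le> e"
    by (force simp: real_norm_def)
  have "(\<lambda>i. \<Sum>j<N. b i j * y j) \<longlonglongrightarrow> (\<Sum>j<N. 0 * y j)"
    by (intro tendsto_intros columns)
  then have "(\<lambda>i. \<Sum>j<N. b i j * y j) \<longlonglongrightarrow> 0" by simp
  from LIMSEQ_D[OF this, of "r / 2"] \<open>r > 0\<close>
  obtain I where I: "\<And>i. i \<ge> I \<Longrightarrow> \<bar>\<Sum>j<N. b i j * y j\<bar> < r / 2"
    by (auto simp: real_norm_def)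
  have "\<bar>\<Sum>j. b i j * y j\<bar> < r" if "i \<ge> max I m" for i
  proof -
    have row: "summable (\<lambda>j. \<bar>b i j\<bar>)" using rows(1) that by simp
    have tail: "summable (\<lambda>j. \<bar>b i (j + N)\<bar>)" using summable_ignore_initial_segment[OF row] .
    have dom: "\<bar>b i (j + N) * y (j + N)\<bar> \<le> \<bar>b i (j + N)\<bar> * e" for j
      using N[of "j + N"] by (simp add: abs_mult mult_left_mono)
    have sum: "summable (\<lambda>j. b i j * y j)"
      using row y by (intro summable_abs_mult_Bseq) (auto simp: convergent_imp_Bseq convergentI)
    have abs_tail: "summable (\<lambda>j. \<bar>b i (j + N) * y (j + N)\<bar>)"
      using dom by (intro summable_comparison_test'[OF summable_mult2[OF tail, of e]]) auto
    have "\<bar>\<Sum>j. b i (j + N) * y (j + N)\<bar> \<le> (\<Sum>j. \<bar>b i (j + N) * y (j + N)\<bar>)"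
      by (rule summable_rabs[OF abs_tail])
    also have "\<dots> \<le> (\<Sum>j. \<bar>b i (j + N)\<bar> * e)"
      by (rule suminf_le[OF dom abs_tail summable_mult2[OF tail]])
    also have "\<dots> = (\<Sum>j. \<bar>b i (j + N)\<bar>) * e"
      by (rule suminf_mult2[OF tail, symmetric])
    also have "\<dots> \<le> K * e"
    proof (rule mult_right_mono)
      have "(\<Sum>j. \<bar>b i (j + N)\<bar>) \<le> (\<Sum>j. \<bar>b i j\<bar>)"
        using suminf_split_initial_segment[OF row, of N] by (simp add: sum_nonneg)
      then show "(\<Sum>j. \<bar>b i (j + N)\<bar>) \<le> K" using rows(2)[of i] that by simp
    qed (use \<open>e > 0\<close> in simp)
    finally have "\<bar>\<Sum>j. b i (j + N) * y (j + N)\<bar> < r / 2" using Ke by simp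
    with I[of i] that suminf_split_initial_segment[OF sum, of N] show ?thesis by simp
  qed
  then show "\<exists>I. \<forall>i\<ge>I. norm ((\<Sum>j. b i j * y j) - 0) < r"
    by (intro exI[of _ "max I m"]) simp
qed

text \<open>The differences \<open>x j - L\<close> are transformed to a null sequence, and the constant \<open>L\<close> is
  multiplied by row sums that tend to 1.\<close>

lemma Toeplitz_LIMSEQ:
  fixes b :: "nat \<Rightarrow> nat \<Rightarrow> real"
  assumes rows: "\<And>i. i \<ge> m \<Longrightarrow> summable (\<lambda>j. \<bar>b i j\<bar>)" "\<And>i. i \<ge> m \<Longrightarrow> (\<Sum>j. \<bar>b i j\<bar>) \<le> K"
    and columns: "\<And>j. (\<lambda>i. b i j) \<longlonglongrightarrow> 0"
    and row_sums: "(\<lambda>i. \<Sum>j. b i j) \<longlonglongrightarrow> 1"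
    and x: "x \<longlonglongrightarrow> L"
  shows "(\<lambda>i. \<Sum>j. b i j * x j) \<longlonglongrightarrow> L"
proof -
  have "(\<lambda>i. \<Sum>j. b i j * (x j - L)) \<longlonglongrightarrow> 0"
    using x by (intro Toeplitz_LIMSEQ_zero[OF rows columns]) (auto simp: LIM_zero)
  then have "(\<lambda>i. (\<Sum>j. b i j * (x j - L)) + (\<Sum>j. b i j) * L) \<longlonglongrightarrow> 0 + 1 * L"
    by (intro tendsto_intros row_sums)
  moreover have "(\<Sum>j. b i j * (x j - L)) + (\<Sum>j. b i j) * L = (\<Sum>j. b i j * x j)" if "i \<ge> m" for i
  proof -
    have row: "summable (b i)" using rows(1)[OF that] by (rule summable_rabs_cancel)
    have "Bseq (\<lambda>j. x j - L)"
      using x by (intro convergent_imp_Bseq convergentI[of _ 0]) (simp add: LIM_zero)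
    then have "summable (\<lambda>j. b i j * (x j - L))"
      by (rule summable_abs_mult_Bseq[OF rows(1)[OF that]])
    from suminf_add[OF this summable_mult2[OF row, of L]] show ?thesis
      by (simp add: suminf_mult2[OF row, symmetric] right_diff_distrib)
  qed
  then have "\<forall>\<^sub>F i in sequentially.
      (\<Sum>j. b i j * (x j - L)) + (\<Sum>j. b i j) * L = (\<Sum>j. b i j * x j)"
    by (auto simp: eventually_sequentially)
  ultimately show ?thesis
    by (auto dest: tendsto_cong)
qed

text \<open>The norm counts column 0 as well, and leaving it out can only decrease a row sum.\<close>

lemma regular_summability_rows:
  assumes "regular_summability a K" "i \<ge> 1"
  shows "summable (\<lambda>j. \<bar>a i (Suc j)\<bar>)" "(\<Sum>j. \<bar>a i (Suc j)\<bar>) \<le> K"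
proof -
  have "(\<Sum>j. ereal \<bar>a i j\<bar>) \<le> (SUP i\<in>{1..}. \<Sum>j. ereal \<bar>a i j\<bar>)"
    using \<open>i \<ge> 1\<close> by (intro SUP_upper) auto
  then have le: "(\<Sum>j. ereal \<bar>a i j\<bar>) \<le> ereal K"
    using assms by (simp add: regular_summability_def)
  have bound: "(\<Sum>j<n. \<bar>a i (Suc j)\<bar>) \<le> K" for n
  proof -
    have "ereal (\<Sum>j<Suc n. \<bar>a i j\<bar>) \<le> (\<Sum>j. ereal \<bar>a i j\<bar>)"
      using suminf_upper[of "\<lambda>j. ereal \<bar>a i j\<bar>" "Suc n"] by simp
    also note le
    finally show ?thesis
      by (subst (asm) sum.lessThan_Suc_shift) simp
  qed
  show "summable (\<lambda>j. \<bar>a i (Suc j)\<bar>)"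
    by (rule summableI_nonneg_bounded[OF _ bound]) simp
  then show "(\<Sum>j. \<bar>a i (Suc j)\<bar>) \<le> K"
    by (rule suminf_le_const) (rule bound)
qed

section \<open>Almost sure convergence of the transform\<close>

theorem proposition3p2:
  fixes P :: "'w measure"
    and X :: "nat \<Rightarrow> 'w \<Rightarrow> extr" and X_inf :: "'w \<Rightarrow> extr"
    and a :: "nat \<Rightarrow> nat \<Rightarrow> real" and K :: real
  assumes "prob_space P"
    and "\<And>n. n \<ge> 1 \<Longrightarrow> X n \<in> measurable P extr_rays"
    and "X_inf \<in> measurable P extr_rays"
    and "\<And>n. n \<ge> 1 \<Longrightarrow> measure P {w \<in> space P. X n w \<in> extr_reals} = 1"
    and "measure P {w \<in> space P. X_inf w \<in> extr_reals} = 1"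
    and "regular_summability a K"
    and "as_converges P X X_inf"
  shows "as_converges P (matrix_transform a X) X_inf"
proof -
  interpret prob_space P by fact
  \<comment> \<open>At index 0 the zero function serves as a default, so that all \<open>x n\<close> are measurable.\<close>
  have "\<exists>v. v \<in> borel_measurable P \<and> (n \<ge> 1 \<longrightarrow> (AE w in P. X n w = Ext (v w) 0))" for n
    using ex_borel_measurable_fin_part[of "X n"] assms(2,4) by (cases "n \<ge> 1") (auto simp: Bex_def intro: exI[of _ "\<lambda>_. 0"])
  then obtain x where x [measurable]: "\<And>n. x n \<in> borel_measurable P"
    and "\<And>n. n \<ge> 1 \<Longrightarrow> AE w in P. X n w = Ext (x n w) 0"
    by metis
  then have X: "AE w in P. \<forall>n\<ge>1. X n w = Ext (x n w) 0"
    by (auto simp: AE_all_countable)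
  obtain z where z [measurable]: "z \<in> borel_measurable P" and Z: "AE w in P. X_inf w = Ext (z w) 0"
    using ex_borel_measurable_fin_part[OF assms(3,5)] by blast
  have conv: "AE w in P. (\<lambda>n. x n w) \<longlonglongrightarrow> z w"
    using assms(7) as_converges_iff_AE_LIMSEQ[of x z X_inf X] X Z by simp

  define y where "y n w = (\<Sum>j. a n (Suc j) * x (Suc j) w)" for n w
  note rows = regular_summability_rows[OF assms(6)]
  have "(\<lambda>i. a i (Suc j)) \<longlonglongrightarrow> 0" for j
    using assms(6) by (simp add: regular_summability_def)
  moreover have "(\<lambda>i. \<Sum>j. a i (Suc j)) \<longlonglongrightarrow> 1"
    using assms(6) by (simp add: regular_summability_def)
  ultimately have Toeplitz: "(\<lambda>n. \<Sum>j. a n (Suc j) * t j) \<longlonglongrightarrow> L" if "t \<longlonglongrightarrow> L" for t L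
    using rows that by (intro Toeplitz_LIMSEQ[where m = 1 and K = K]) auto
  have "AE w in P. (\<lambda>n. y n w) \<longlonglongrightarrow> z w"
    using conv by eventually_elim (unfold y_def, intro Toeplitz LIMSEQ_Suc)
  moreover have "AE w in P. X_inf w = Ext (z w) 0 \<and>
      (\<forall>n\<ge>1. matrix_transform a X n w = Ext (y n w) 0)"
    using X Z conv
  proof eventually_elim
    case (elim w)
    have "Bseq (\<lambda>j. x (Suc j) w)"
      using LIMSEQ_Suc[OF elim(3)] by (intro convergent_imp_Bseq convergentI)
    then have "summable (\<lambda>j. a n (Suc j) * x (Suc j) w)" if "n \<ge> 1" for n
      by (rule summable_abs_mult_Bseq[OF rows(1)[OF that]])
    with elim(1,2) show ?case
      by (simp add: matrix_transform_def y_def scaleR_extr_def suminf_Ext_0)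
  qed
  moreover have "y n \<in> borel_measurable P" for n
    unfolding y_def by measurable
  ultimately show ?thesis
    using as_converges_iff_AE_LIMSEQ[of y z X_inf "matrix_transform a X"] by simp
qed

end
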